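(* Let $\mu_4$ be the morphism on the alphabet $\{0,1,\dots,9,a,b,c,d,e,f,g,h\}$ defined by $0\mapsto 01$, $1\mapsto 2$, $2\mapsto 34$, $3\mapsto 56$, $4\mapsto 7$, $5\mapsto 89$, $6\mapsto a$, $7\mapsto bc$, $8\mapsto dc$, $9\mapsto d$, $a\mapsto ef$, $b\mapsto ef$, $c\mapsto e$, $d\mapsto 7g$, $e\mapsto eh$, $f\mapsto b$, $g\mapsto d$, $h\mapsto b$, and let $\rho_4$ be the coding $0,3,7,8,9,b,c,d,e,h\mapsto 1$; $1,2,a\mapsto 2$; $4,5,6,f,g\mapsto 0$. Let $g_4(n)$ be the $n$-th symbol (indexing from $0$) of the infinite word $\rho_4(\mu_4^\omega(0))$, where $\mu_4^\omega(0)$ is the fixed point of $\mu_4$ starting with $0$. Then a position $(a,b)$ with $a\le b$ is a $\mathcal{P}$-position of $K^4$ if and only if either $a+b\le 4$, or there exists $n\ge 0$ with \[ a=\lfloor (n+2)\phi\rfloor+g_4(n+1)\quad\text{and}\quad b=\lfloor (n+2)\phi^2\rfloor+g_4(n+1)+3 . \]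
   Context: $\phi=(1+\sqrt5)/2$. Positions are pairs $(x,y)\in\mathbb{N}^2$. A Wythoff move from $(x,y)$ leads to $(x-i,y)$ with $1\le i\le x$, to $(x,y-i)$ with $1\le i\le y$, or to $(x-i,y-i)$ with $1\le i\le\min(x,y)$. For $\ell\in\mathbb{N}$, $K^\ell$ is the two-player impartial game with Wythoff moves in which the positions of $\{(x,y): x+y\le\ell\}$ are terminal: no move is allowed from a terminal position, and a player who moves into a terminal position wins (normal play). A $\mathcal{P}$-position is a position from which the previous player has a winning strategy; terminal positions are $\mathcal{P}$-positions. *)

theory Defs
  imports Complex_Main "HOL-Library.Stream"
begin

definition phi :: real where
  "phi = (1 + sqrt 5) / 2"


section \<open>The games\<close>

type_synonym position = "nat \<times> nat"

inductive wythoff_move :: "position \<Rightarrow> position \<Rightarrow> bool" where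
  "1 \<le> i \<Longrightarrow> i \<le> x \<Longrightarrow> wythoff_move (x, y) (x - i, y)"
| "1 \<le> i \<Longrightarrow> i \<le> y \<Longrightarrow> wythoff_move (x, y) (x, y - i)"
| "1 \<le> i \<Longrightarrow> i \<le> min x y \<Longrightarrow> wythoff_move (x, y) (x - i, y - i)"

definition terminal :: "nat \<Rightarrow> position \<Rightarrow> bool" where
  "terminal l p \<longleftrightarrow> fst p + snd p \<le> l"

definition K_move :: "nat \<Rightarrow> position \<Rightarrow> position \<Rightarrow> bool" where
  "K_move l p q \<longleftrightarrow> \<not> terminal l p \<and> wythoff_move p q"

definition partial_play :: "nat \<Rightarrow> position \<Rightarrow> position list \<Rightarrow> bool" where
  "partial_play l p ps \<longleftrightarrow> ps \<noteq> [] \<and> hd ps = p \<and> successively (K_move l) ps"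

text \<open>
  A strategy maps the history of a play, listed from its starting position to the current position,
  to the next position. At the starting position (index 0) the next player is on move, so the
  previous player is the one who moves away from the positions of odd index.
\<close>

type_synonym strategy = "position list \<Rightarrow> position"

definition previous_follows :: "strategy \<Rightarrow> position list \<Rightarrow> bool" where
  "previous_follows s ps \<longleftrightarrow> (\<forall>i. odd i \<and> Suc i < length ps \<longrightarrow> ps ! Suc i = s (take (Suc i) ps))"

text \<open>
  The strategy has to prescribe a legal move whenever the previous player is to move in a
  non-terminal position, and every finished play that follows it has to be won by the previous
  player. The winner is the player who moved into the terminal position. That is the previous
  player iff the number of moves, which is one less than the number of positions, is even; this
  includes the play without any move. There are no infinite plays, as \<open>x + y\<close> decreases.
\<close>

definition previous_winning_strategy :: "nat \<Rightarrow> position \<Rightarrow> strategy \<Rightarrow> bool" where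
  "previous_winning_strategy l p s \<longleftrightarrow>
     (\<forall>ps. partial_play l p ps \<and> previous_follows s ps \<longrightarrow>
        (\<not> terminal l (last ps) \<and> even (length ps) \<longrightarrow> K_move l (last ps) (s ps)) \<and>
        (terminal l (last ps) \<longrightarrow> odd (length ps)))"

definition P_position :: "nat \<Rightarrow> position \<Rightarrow> bool" where
  "P_position l p \<longleftrightarrow> (\<exists>s. previous_winning_strategy l p s)"


section \<open>The morphic word\<close>

datatype letter =
  L0 | L1 | L2 | L3 | L4 | L5 | L6 | L7 | L8 | L9 | La | Lb | Lc | Ld | Le | Lf | Lg | Lh

fun mu4 :: "letter \<Rightarrow> letter list" where
  "mu4 L0 = [L0, L1]"
| "mu4 L1 = [L2]"
| "mu4 L2 = [L3, L4]"
| "mu4 L3 = [L5, L6]"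
| "mu4 L4 = [L7]"
| "mu4 L5 = [L8, L9]"
| "mu4 L6 = [La]"
| "mu4 L7 = [Lb, Lc]"
| "mu4 L8 = [Ld, Lc]"
| "mu4 L9 = [Ld]"
| "mu4 La = [Le, Lf]"
| "mu4 Lb = [Le, Lf]"
| "mu4 Lc = [Le]"
| "mu4 Ld = [L7, Lg]"
| "mu4 Le = [Le, Lh]"
| "mu4 Lf = [Lb]"
| "mu4 Lg = [Ld]"
| "mu4 Lh = [Lb]"

fun rho4 :: "letter \<Rightarrow> nat" where
  "rho4 L0 = 1"
| "rho4 L1 = 2"
| "rho4 L2 = 2"
| "rho4 L3 = 1"
| "rho4 L4 = 0"
| "rho4 L5 = 0"
| "rho4 L6 = 0"
| "rho4 L7 = 1"
| "rho4 L8 = 1"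
| "rho4 L9 = 1"
| "rho4 La = 2"
| "rho4 Lb = 1"
| "rho4 Lc = 1"
| "rho4 Ld = 1"
| "rho4 Le = 1"
| "rho4 Lf = 0"
| "rho4 Lg = 0"
| "rho4 Lh = 1"

text \<open>
  Infinite words are streams, and \<open>flat (smap \<mu> w)\<close> is the image of \<open>w\<close> under the (non-erasing)
  morphism \<open>\<mu>\<close>. The lemma \<open>mu4_fixed_point_unique\<close> below shows that the description is proper.
\<close>

definition mu4_omega :: "letter stream" where
  "mu4_omega = (THE w. shd w = L0 \<and> flat (smap mu4 w) = w)"

definition g4 :: "nat \<Rightarrow> nat" where
  "g4 n = smap rho4 mu4_omega !! n"

lemma stream_eq_snth: "u = v \<longleftrightarrow> (\<forall>n. u !! n = v !! n)"
  by (metis ext stream_smap_nats)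

lemma mu4_nonempty: "mu4 c \<noteq> []"
  by (cases c) auto

lemma flat_smap_mu4_shift:
  "flat (smap mu4 (xs @- w)) = concat (map mu4 xs) @- flat (smap mu4 w)"
  by (induction xs) (simp_all add: mu4_nonempty flat_Stream)

lemma length_concat_mu4: "length xs \<le> length (concat (map mu4 xs))"
proof (induction xs)
  case (Cons c xs)
  have "1 \<le> length (mu4 c)"
    using mu4_nonempty[of c] by (cases "mu4 c") auto
  with Cons show ?case by simp
qed simp

lemma mu4_fixed_point_unique: "\<exists>!w. shd w = L0 \<and> flat (smap mu4 w) = w"
proof -
  define F where "F = (\<lambda>xs. concat (map mu4 xs))"
  define X where "X k = (F ^^ k) [L0]" for k
  have F_append: "F (xs @ ys) = F xs @ F ys" for xs ys by (simp add: F_def)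
  have X_Suc: "X (Suc k) = F (X k)" for k by (simp add: X_def)
  have X_ext: "\<exists>ys. ys \<noteq> [] \<and> X (Suc k) = X k @ ys" for k
  proof (induction k)
    case 0
    show ?case by (simp add: X_def F_def)
  next
    case (Suc k)
    then obtain ys where ys: "ys \<noteq> []" "X (Suc k) = X k @ ys" by blast
    have "X (Suc (Suc k)) = X (Suc k) @ F ys"
      using ys(2) by (metis F_append X_Suc)
    moreover have "F ys \<noteq> []"
      using ys(1) length_concat_mu4[of ys] by (auto simp: F_def simp del: concat_eq_Nil_conv)
    ultimately show ?case by blast
  qed
  have X_len: "k < length (X k)" for k
  proof (induction k)
    case 0 show ?case by (simp add: X_def)
  next
    case (Suc k)
    obtain ys where "ys \<noteq> []" "X (Suc k) = X k @ ys" using X_ext by blast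
    with Suc show ?case by (cases ys) auto
  qed
  have X_pre: "\<exists>ys. X (k + j) = X k @ ys" for k j
  proof (induction j)
    case (Suc j)
    then show ?case using X_ext[of "k + j"] by (metis add_Suc_right append.assoc)
  qed simp
  have X_nth: "X j ! n = X k ! n" if "n < length (X k)" "k \<le> j" for j k n
    using X_pre[of k "j - k"] that by (auto simp: nth_append)
  define w where "w = smap (\<lambda>n. X n ! n) nats"
  have w_nth: "w !! n = X k ! n" if "n < length (X k)" for n k
    using X_nth[of n k n] X_nth[of n n k] X_len[of n] that
    by (cases "k \<le> n") (auto simp: w_def)
  have w_stake: "stake (length (X k)) w = X k" for k
    by (rule nth_equalityI) (auto simp: w_nth)
  have w_fixed: "flat (smap mu4 w) !! n = w !! n" for n
  proof -
    define m where "m = length (X n)"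
    have "w = X n @- sdrop m w"
      using w_stake[of n] stake_sdrop[of m w] by (simp add: m_def)
    then have "flat (smap mu4 w) = X (Suc n) @- flat (smap mu4 (sdrop m w))"
      using flat_smap_mu4_shift[of "X n" "sdrop m w"] by (simp add: X_Suc F_def)
    moreover have "n < length (X (Suc n))" using X_len[of "Suc n"] by simp
    ultimately show ?thesis using w_nth[of n "Suc n"] by simp
  qed
  have "shd w = L0"
    using w_nth[of 0 0] by (simp add: X_def)
  moreover have "flat (smap mu4 w) = w"
    using w_fixed by (simp add: stream_eq_snth)
  moreover have "u = v" if u: "shd u = L0" "flat (smap mu4 u) = u"
    and v: "shd v = L0" "flat (smap mu4 v) = v" for u v
  proof -
    have pre: "stake (Suc n) u = stake (Suc n) v" for n
    proof (induction n)
      case 0 show ?case using u(1) v(1) by simp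
    next
      case (Suc n)
      define xs where "xs = stake (Suc n) u"
      have 1: "u = F xs @- flat (smap mu4 (sdrop (Suc n) u))"
        using flat_smap_mu4_shift[of xs "sdrop (Suc n) u"] u(2)
        by (simp only: xs_def F_def stake_sdrop)
      have 2: "v = F xs @- flat (smap mu4 (sdrop (Suc n) v))"
        using flat_smap_mu4_shift[of xs "sdrop (Suc n) v"] v(2)
        by (simp only: xs_def Suc F_def stake_sdrop)
      have "xs = L0 # stake n (stl u)" using u(1) by (simp add: xs_def)
      then have "length (F xs) \<ge> Suc (Suc n)"
        using length_concat_mu4[of "stake n (stl u)"] by (simp add: F_def)
      then have "stake (Suc (Suc n)) u = take (Suc (Suc n)) (F xs)"
        and "stake (Suc (Suc n)) v = take (Suc (Suc n)) (F xs)"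
        using 1 2 stake_shift
        by (metis append_Nil2 diff_is_0_eq stake.simps(1))+
      then show ?case by simp
    qed
    have "u !! n = v !! n" for n
      using pre[of n] by (metis lessI stake_nth)
    then show ?thesis by (simp add: stream_eq_snth)
  qed
  ultimately show ?thesis by blast
qed

end

theory Submission
  imports Defs
begin

text \<open>
  Write \<open>w\<close> for the fixed point and \<open>pos m\<close> for the place where the image of its \<open>m\<close>-th letter begins.
  Since \<open>\<mu>\<^sub>4\<close> projects onto the Fibonacci morphism, \<open>pos m = \<lfloor>(m + 1) \<phi>\<rfloor> - 1\<close>, so the claimed smaller
  coordinate is \<open>A m = pos m + 1 + \<rho>\<^sub>4 (w m)\<close> with \<open>m = n + 1\<close>: the word \<open>w\<close> at index \<open>A m\<close> lies in the
  image of a short factor starting at \<open>m\<close>. Inspecting the finitely many factors of length 3 shows that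
  \<open>A (j + 1) - A j\<close> is \<open>2\<close> if \<open>j\<close> is a value of \<open>A\<close>, and \<open>1\<close> otherwise. Hence the integers \<open>\<ge> 5\<close>
  omitted by \<open>A\<close> are the \<open>A (A m) + 1 = A m + m + 4\<close>, which is the larger coordinate, and the Wythoff
  argument applies.
\<close>

section \<open>Kernels of the game\<close>

lemma wythoff_move_sum: "wythoff_move p q \<Longrightarrow> fst q + snd q < fst p + snd p"
  by (induction rule: wythoff_move.induct) auto

text \<open>Avoiding natural subtraction turns questions about moves into linear arithmetic; a
  diagonal move is one that keeps the difference of the coordinates.\<close>

lemma wythoff_move_iff:
  "wythoff_move (x, y) (x', y') \<longleftrightarrow>
     x' < x \<and> y' = y \<or> x' = x \<and> y' < y \<or> x' < x \<and> y' < y \<and> x + y' = x' + y"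
proof
  show "wythoff_move (x, y) (x', y') \<Longrightarrow>
     x' < x \<and> y' = y \<or> x' = x \<and> y' < y \<or> x' < x \<and> y' < y \<and> x + y' = x' + y"
    by (cases rule: wythoff_move.cases) auto
  assume "x' < x \<and> y' = y \<or> x' = x \<and> y' < y \<or> x' < x \<and> y' < y \<and> x + y' = x' + y"
  then consider "x' < x" "y' = y" | "x' = x" "y' < y" | "x' < x" "y' < y" "x + y' = x' + y"
    by blast
  then show "wythoff_move (x, y) (x', y')"
  proof cases
    case 1
    then show ?thesis using wythoff_move.intros(1)[of "x - x'" x y] by simp
  next
    case 2
    then show ?thesis using wythoff_move.intros(2)[of "y - y'" y x] by simp
  next
    case 3
    then have "y - (x - x') = y'" by arith
    then show ?thesis using 3 wythoff_move.intros(3)[of "x - x'" x y] by simp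
  qed
qed

lemma wythoff_move_swap: "wythoff_move (y, x) (y', x') \<longleftrightarrow> wythoff_move (x, y) (x', y')"
  by (auto simp: wythoff_move_iff)

section \<open>Histories of plays and kernels\<close>

lemma partial_play_snoc:
  "ps \<noteq> [] \<Longrightarrow>
    partial_play l p (ps @ [q]) \<longleftrightarrow> partial_play l p ps \<and> K_move l (last ps) q"
  by (auto simp: partial_play_def successively_append_iff)

text \<open>Only a history of even length leaves the previous player on move, so only there does
  \<open>s\<close> dictate the next position.\<close>

lemma previous_follows_snoc:
  assumes "ps \<noteq> []"
  shows "previous_follows s (ps @ [q]) \<longleftrightarrow>
    previous_follows s ps \<and> (even (length ps) \<longrightarrow> q = s ps)"
proof
  assume L: "previous_follows s (ps @ [q])"
  have "ps ! Suc i = s (take (Suc i) ps)" if "odd i" "Suc i < length ps" for i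
    using L that unfolding previous_follows_def
    by (elim allE[of _ i]) (simp add: nth_append)
  moreover have "q = s ps" if "even (length ps)"
  proof -
    have "odd (length ps - 1)" "Suc (length ps - 1) = length ps"
      using that assms by (cases ps; simp)+
    then show ?thesis
      using L unfolding previous_follows_def by (elim allE[of _ "length ps - 1"]) simp
  qed
  ultimately show "previous_follows s ps \<and> (even (length ps) \<longrightarrow> q = s ps)"
    unfolding previous_follows_def by blast
next
  assume R: "previous_follows s ps \<and> (even (length ps) \<longrightarrow> q = s ps)"
  show "previous_follows s (ps @ [q])"
    unfolding previous_follows_def
  proof (intro allI impI, elim conjE)
    fix i assume i: "odd i" "Suc i < length (ps @ [q])"
    show "(ps @ [q]) ! Suc i = s (take (Suc i) (ps @ [q]))"
    proof (cases "Suc i = length ps")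
      case True
      then have "even (length ps)" using i(1) by (metis even_Suc)
      then show ?thesis using R True by simp
    next
      case False
      then have "Suc i < length ps" using i(2) by simp
      then show ?thesis using R i(1) unfolding previous_follows_def by (simp add: nth_append)
    qed
  qed
qed

text \<open>A kernel of the move relation in the sense of directed graphs; since every play ends, it
  can only be the set of positions won by the previous player.\<close>

locale kernel =
  fixes l :: nat and S :: "position set"
  assumes terminal_in: "terminal l p \<Longrightarrow> p \<in> S"
    and independent: "p \<in> S \<Longrightarrow> K_move l p q \<Longrightarrow> q \<notin> S"
    and absorbing: "p \<notin> S \<Longrightarrow> \<exists>q\<in>S. K_move l p q"
begin

text \<open>The previous player always answers into \<open>S\<close>, so the current position lies
  in \<open>S\<close> exactly when the history has odd length, that is, when the next player is on
  move.\<close>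

lemma P_position_if_in_kernel:
  assumes "p \<in> S"
  shows "P_position l p"
proof -
  define s :: strategy where "s ps = (SOME q. q \<in> S \<and> K_move l (last ps) q)" for ps
  have s: "s ps \<in> S" "K_move l (last ps) (s ps)" if "last ps \<notin> S" for ps
    using someI_ex[of "\<lambda>q. q \<in> S \<and> K_move l (last ps) q"] absorbing[OF that]
    unfolding s_def by blast+
  have inv: "last ps \<in> S \<longleftrightarrow> odd (length ps)"
    if "partial_play l p ps" "previous_follows s ps" for ps
    using that
  proof (induction ps rule: rev_induct)
    case Nil
    then show ?case by (simp add: partial_play_def)
  next
    case (snoc q ps)
    show ?case
    proof (cases "ps = []")
      case True
      then show ?thesis using snoc.prems assms by (simp add: partial_play_def)
    next
      case False
      then have pl: "partial_play l p ps" "K_move l (last ps) q" "previous_follows s ps"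
          "even (length ps) \<longrightarrow> q = s ps"
        using snoc.prems by (auto simp: partial_play_snoc previous_follows_snoc)
      then have "last ps \<in> S \<longleftrightarrow> odd (length ps)" using snoc.IH by blast
      then show ?thesis
        using pl s(1)[of ps] independent[of "last ps" q] by (cases "odd (length ps)") simp_all
    qed
  qed
  have "previous_winning_strategy l p s"
    unfolding previous_winning_strategy_def using inv s(2) terminal_in by blast
  then show ?thesis unfolding P_position_def by blast
qed

text \<open>Facing a position outside \<open>S\<close>, the next player could move into
  \<open>S\<close>. By induction on the coordinate sum the reply of \<open>s\<close> would again lie
  in \<open>S\<close>, against independence.\<close>

lemma previous_strategy_loses:
  assumes "previous_winning_strategy l p s" "partial_play l p ps" "previous_follows s ps"
    "odd (length ps)"
  shows "last ps \<in> S"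
  using assms(2-4)
proof (induction "fst (last ps) + snd (last ps)" arbitrary: ps rule: less_induct)
  case less
  show ?case
  proof (rule ccontr)
    assume "last ps \<notin> S"
    then obtain q where q: "q \<in> S" "K_move l (last ps) q" using absorbing by blast
    define qs where "qs = ps @ [q]"
    have "ps \<noteq> []" using less.prems by (simp add: partial_play_def)
    then have qs: "partial_play l p qs" "previous_follows s qs" "even (length qs)" "last qs = q"
        "qs \<noteq> []"
      using less.prems q by (auto simp: qs_def partial_play_snoc previous_follows_snoc)
    \<comment> \<open>A finished play of even length is lost for the previous player, so
      \<open>q\<close> is not terminal and \<open>s\<close> owes a legal reply.\<close>
    then have nt: "\<not> terminal l q" and mv: "K_move l q (s qs)"
      using assms(1) unfolding previous_winning_strategy_def by blast+
    have rs: "partial_play l p (qs @ [s qs])" "previous_follows s (qs @ [s qs])"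
        "odd (length (qs @ [s qs]))"
      using qs mv by (auto simp: partial_play_snoc previous_follows_snoc)
    have "fst (s qs) + snd (s qs) < fst (last ps) + snd (last ps)"
      using mv q(2) wythoff_move_sum unfolding K_move_def by (meson less_trans)
    then have "s qs \<in> S"
      using less.hyps[of "qs @ [s qs]"] rs by simp
    then show False using independent[OF q(1) mv] by blast
  qed
qed

theorem P_position_iff: "P_position l p \<longleftrightarrow> p \<in> S"
proof
  assume "P_position l p"
  then obtain s where "previous_winning_strategy l p s" unfolding P_position_def by blast
  \<comment> \<open>The history without any move has length 1, which is odd.\<close>
  from previous_strategy_loses[OF this, of "[p]"] show "p \<in> S"
    by (simp add: partial_play_def previous_follows_def)
qed (rule P_position_if_in_kernel)

end


section \<open>The fixed point and the Beatty sequence of the golden ratio\<close>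

lemma mu4_omega_fixed: "shd mu4_omega = L0" "flat (smap mu4 mu4_omega) = mu4_omega"
  using theI'[OF mu4_fixed_point_unique] unfolding mu4_omega_def by blast+

abbreviation mu4_word :: "letter list \<Rightarrow> letter list" where
  "mu4_word xs \<equiv> concat (map mu4 xs)"

definition pos :: "nat \<Rightarrow> nat" where
  "pos m = length (mu4_word (stake m mu4_omega))"

text \<open>Long letters play the role of \<open>0\<close> and the others that of \<open>1\<close>
  in the Fibonacci morphism \<open>0 -> 01\<close>, \<open>1 -> 0\<close>.\<close>

definition is_long :: "letter \<Rightarrow> bool" where
  "is_long c \<longleftrightarrow> length (mu4 c) = 2"

lemma pos_0 [simp]: "pos 0 = 0"
  by (simp add: pos_def)

lemma pos_Suc: "pos (Suc m) = pos m + length (mu4 (mu4_omega !! m))"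
  by (simp add: pos_def stake_Suc del: stake.simps)

lemma length_mu4: "length (mu4 c) = (if is_long c then 2 else 1)"
  by (cases c) (auto simp: is_long_def)

text \<open>The tail from \<open>pos m\<close> is the image of the tail from \<open>m\<close>;
  splitting off \<open>k\<close> letters exposes a finite window open to inspection.\<close>

lemma sdrop_pos:
  "sdrop (pos m) mu4_omega
    = mu4_word (stake k (sdrop m mu4_omega)) @- flat (smap mu4 (sdrop (m + k) mu4_omega))"
proof -
  have "mu4_omega = mu4_word (stake m mu4_omega) @- flat (smap mu4 (sdrop m mu4_omega))"
    using flat_smap_mu4_shift[of "stake m mu4_omega" "sdrop m mu4_omega"] mu4_omega_fixed(2)
    by (simp add: stake_sdrop)
  then have "sdrop (pos m) mu4_omega = flat (smap mu4 (sdrop m mu4_omega))"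
    by (metis append_Nil diff_self_eq_0 drop_all order_refl pos_def sdrop.simps(1) sdrop_shift
        shift.simps(1))
  also have "\<dots> = flat (smap mu4 (stake k (sdrop m mu4_omega) @- sdrop (m + k) mu4_omega))"
    by (metis sdrop_add stake_sdrop)
  finally show ?thesis by (simp only: flat_smap_mu4_shift)
qed

lemma nth_pos_window:
  assumes "i < length (mu4_word (stake k (sdrop m mu4_omega)))"
  shows "mu4_omega !! (pos m + i) = mu4_word (stake k (sdrop m mu4_omega)) ! i"
proof -
  have "mu4_omega !! (pos m + i) = sdrop (pos m) mu4_omega !! i"
    by (simp add: sdrop_snth add.commute)
  also have "\<dots> = mu4_word (stake k (sdrop m mu4_omega)) ! i"
    unfolding sdrop_pos[of m k] using assms by simp
  finally show ?thesis .
qed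

lemma nth_pos:
  assumes "i < length (mu4 (mu4_omega !! m))"
  shows "mu4_omega !! (pos m + i) = mu4 (mu4_omega !! m) ! i"
  using nth_pos_window[of i 1 m] assms by simp

lemma is_long_pos: "is_long (mu4_omega !! pos m)"
proof -
  have "is_long (mu4 c ! 0)" for c by (cases c) (auto simp: is_long_def)
  then show ?thesis using nth_pos[of 0 m] by (simp add: length_mu4)
qed

lemma not_is_long_pos:
  assumes "is_long (mu4_omega !! m)"
  shows "\<not> is_long (mu4_omega !! (pos m + 1))"
proof -
  have "is_long c \<Longrightarrow> \<not> is_long (mu4 c ! 1)" for c by (cases c) (auto simp: is_long_def)
  then show ?thesis using nth_pos[of 1 m] assms by (simp add: length_mu4)
qed

lemma pos_0_long: "is_long (mu4_omega !! 0)"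
  using mu4_omega_fixed(1) by (simp add: is_long_def)

lemma mu4_omega_prefix:
  "mu4_omega !! 0 = L0" "mu4_omega !! 1 = L1" "mu4_omega !! 2 = L2"
  "mu4_omega !! 3 = L3" "mu4_omega !! 4 = L4" "mu4_omega !! 5 = L5"
proof -
  show w0: "mu4_omega !! 0 = L0" using mu4_omega_fixed(1) by simp
  show w1: "mu4_omega !! 1 = L1" using nth_pos[of 1 0] w0 by simp
  have p1: "pos 1 = 2" using w0 by (simp add: pos_Suc)
  show w2: "mu4_omega !! 2 = L2" using nth_pos[of 0 1] w1 p1 by simp
  have p2: "pos 2 = 3" using w1 p1 by (simp add: pos_Suc numeral_2_eq_2)
  show w3: "mu4_omega !! 3 = L3" and "mu4_omega !! 4 = L4"
    using nth_pos[of 0 2] nth_pos[of 1 2] w2 p2 by simp_all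
  have p3: "pos 3 = 5" using w2 p2 by (simp add: pos_Suc numeral_3_eq_3 numeral_2_eq_2)
  show "mu4_omega !! 5 = L5" using nth_pos[of 0 3] w3 p3 by simp
qed

text \<open>The long first letter gives a lead that later images never lose. Passing from an index
  to its preimage therefore decreases it, which drives the strong inductions below.\<close>

lemma pos_greater: "m \<ge> 1 \<Longrightarrow> pos m > m"
proof (induction m rule: dec_induct)
  case base
  then show ?case using pos_0_long by (simp add: pos_Suc length_mu4)
next
  case (step m)
  then show ?case by (simp add: pos_Suc length_mu4)
qed

lemma pos_cases:
  obtains m where "n = pos m" | m where "n = pos m + 1" "is_long (mu4_omega !! m)"
proof -
  have "\<exists>m. n = pos m \<or> n = pos m + 1 \<and> is_long (mu4_omega !! m)"
  proof (induction n)
    case 0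
    then show ?case using pos_0 by metis
  next
    case (Suc n)
    then obtain m where "n = pos m \<or> n = pos m + 1 \<and> is_long (mu4_omega !! m)" by blast
    then have "Suc n = pos (Suc m) \<or> Suc n = pos m + 1 \<and> is_long (mu4_omega !! m)"
      by (auto simp: pos_Suc length_mu4)
    then show ?case by blast
  qed
  then show thesis using that by blast
qed

text \<open>The first \<open>m\<close> images contain exactly \<open>m\<close> long letters, one at
  the head of each, so applying the morphism to them lengthens them by \<open>m\<close>.\<close>

lemma pos_pos: "pos (pos m) = pos m + m"
proof (induction m)
  case (Suc m)
  have 1: "pos (Suc (pos m)) = pos m + m + 2"
    using Suc is_long_pos[of m] by (simp add: pos_Suc length_mu4)
  show ?case
  proof (cases "is_long (mu4_omega !! m)")
    case True
    then have "pos (Suc m) = Suc (Suc (pos m))" by (simp add: pos_Suc length_mu4)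
    moreover have "pos (Suc (Suc (pos m))) = pos m + m + 3"
      using 1 not_is_long_pos[OF True] by (simp add: pos_Suc[of "Suc (pos m)"] length_mu4)
    ultimately show ?thesis by simp
  next
    case False
    then have "pos (Suc m) = Suc (pos m)" by (simp add: pos_Suc length_mu4)
    then show ?thesis using 1 by simp
  qed
qed simp

section \<open>The Beatty property of \<open>pos\<close>\<close>

lemma phi_square: "phi\<^sup>2 = phi + 1"
  by (simp add: phi_def power2_eq_square field_simps)

lemma phi_bounds: "3 / 2 < phi" "phi < 2"
proof -
  have "2 < sqrt 5" "sqrt 5 < 3" by (auto simp: real_less_rsqrt real_less_lsqrt)
  then show "3 / 2 < phi" "phi < 2" by (auto simp: phi_def)
qed

text \<open>
  The discrepancy \<open>e m = pos m + 1 - (m + 1) \<phi>\<close> satisfies \<open>e (pos m) = (1 - \<phi>) e m - 1\<close>, because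
  \<open>pos (pos m) = pos m + m\<close>.
\<close>

lemma pos_discrepancy:
  "-1 < real (pos n) + 1 - (real n + 1) * phi \<and> real (pos n) + 1 - (real n + 1) * phi < 0"
proof (induction n rule: less_induct)
  case (less n)
  show ?case
  proof (cases "n = 0")
    case True
    then show ?thesis using phi_bounds by simp
  next
    case False
    \<comment> \<open>The upper bound \<open>phi - 2\<close>, sharper than \<open>0\<close>, leaves
      room for the second case below, where the step to \<open>pos m + 1\<close> adds
      \<open>2 - phi\<close>.\<close>
    have main: "-1 < real (pos (pos m)) + 1 - (real (pos m) + 1) * phi \<and>
        real (pos (pos m)) + 1 - (real (pos m) + 1) * phi < phi - 2"
      if "m < n" for m
    proof -
      define e where "e = real (pos m) + 1 - (real m + 1) * phi"
      have e: "-1 < e" "e < 0" using less[OF that] by (auto simp: e_def)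
      \<comment> \<open>The last summand is zero; with it the identity holds for every value of
        \<open>phi\<close>.\<close>
      have "real (pos (pos m)) + 1 - (real (pos m) + 1) * phi = e * (1 - phi) - 1
          + (real m + 1) * (phi + 1 - phi\<^sup>2)"
        by (simp add: pos_pos e_def algebra_simps power2_eq_square)
      then have *: "real (pos (pos m)) + 1 - (real (pos m) + 1) * phi = e * (1 - phi) - 1"
        by (simp add: phi_square)
      have "0 < (- e) * (phi - 1)" "(- e) * (phi - 1) < 1 * (phi - 1)"
        using e phi_bounds by (intro mult_pos_pos mult_strict_right_mono; simp)+
      then show ?thesis unfolding * by (simp add: algebra_simps)
    qed
    show ?thesis
    proof (rule pos_cases[of n])
      fix m assume m: "n = pos m"
      with False have "m \<noteq> 0" using pos_0 by metis
      then have "m < n" using pos_greater[of m] m by simp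
      from main[OF this] show ?thesis
        using phi_bounds unfolding m by linarith
    next
      fix m assume m: "n = pos m + 1" "is_long (mu4_omega !! m)"
      then have "m < n" using pos_greater[of m] by (cases "m = 0") auto
      moreover have "pos n = pos (pos m) + 2"
        using m(1) is_long_pos[of m] by (simp add: pos_Suc length_mu4)
      ultimately show ?thesis
        using main[of m] phi_bounds unfolding m(1) by (simp add: algebra_simps)
    qed
  qed
qed

lemma floor_phi_multiple: "\<lfloor>real (m + 1) * phi\<rfloor> = int (pos m) + 1"
  using pos_discrepancy[of m] by (intro floor_unique) (auto simp: algebra_simps)

lemma floor_phi_square_multiple: "\<lfloor>real (m + 1) * phi\<^sup>2\<rfloor> = int (pos m) + 1 + int (m + 1)"
proof -
  have "real (m + 1) * phi\<^sup>2 = real (m + 1) * phi + real (m + 1)"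
    by (simp add: phi_square algebra_simps)
  then have "\<lfloor>real (m + 1) * phi\<^sup>2\<rfloor> = \<lfloor>real (m + 1) * phi + of_int (int (m + 1))\<rfloor>"
    by simp
  then show ?thesis unfolding floor_add_int[symmetric] floor_phi_multiple .
qed


section \<open>The two complementary sequences\<close>

text \<open>The factors of length 3 of the fixed point, except the prefix \<open>[L0, L1, L2]\<close>.\<close>

definition factors3 :: "letter list list" where
  "factors3 = [[L1,L2,L3], [L2,L3,L4], [L3,L4,L5], [L4,L5,L6], [L5,L6,L7], [L6,L7,L8],
    [L7,L8,L9], [L8,L9,La], [L9,La,Lb], [La,Lb,Lc], [Lb,Lc,Ld], [Lc,Ld,Lc],
    [Ld,Lc,Ld], [Lc,Ld,Le], [Ld,Le,Lf], [Le,Lf,Le], [Lf,Le,Lf], [Lf,Le,L7],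
    [Le,L7,Lg], [L7,Lg,Le], [Lg,Le,L7], [Lg,Le,Lh], [Le,Lh,Lb], [Lh,Lb,Le],
    [Lb,Le,Lh], [Lh,Lb,Lc], [Ld,Le,Lh], [Lb,Le,Lf], [Lf,Le,Lh]]"

text \<open>Evaluation on the list confirms that a window starting inside the image of the first
  letter of a factor fits into the image of the whole factor and is listed again.\<close>

lemma factors3_closed:
  "\<forall>v\<in>set factors3. \<forall>r\<in>set [0..<length (mu4 (hd v))].
     3 \<le> length (drop r (mu4_word v)) \<and> take 3 (drop r (mu4_word v)) \<in> set factors3"
  by code_simp

text \<open>Descend from \<open>n\<close> to the index whose image covers it. The image of index 0
  covers only 0 and 1, so the descent ends at index 1, whose window is read off the prefix.\<close>

lemma window_in_factors3:
  assumes "m \<ge> 1"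
  shows "stake 3 (sdrop m mu4_omega) \<in> set factors3"
  using assms
proof (induction m rule: less_induct)
  case (less n)
  show ?case
  proof (cases "n = 1")
    case True
    have "stake 3 (sdrop 1 mu4_omega) = [L1, L2, L3]"
      using mu4_omega_prefix by (simp add: numeral_3_eq_3 numeral_2_eq_2)
    then show ?thesis using True by (simp add: factors3_def)
  next
    case False
    have "\<exists>m r. n = pos m + r \<and> r < length (mu4 (mu4_omega !! m))"
    proof (rule pos_cases[of n])
      fix m assume "n = pos m"
      then show ?thesis by (intro exI[of _ m] exI[of _ 0]) (simp add: length_mu4)
    next
      fix m assume "n = pos m + 1" "is_long (mu4_omega !! m)"
      then show ?thesis by (intro exI[of _ m] exI[of _ 1]) (simp add: length_mu4)
    qed
    then obtain m r where mr: "n = pos m + r" "r < length (mu4 (mu4_omega !! m))" by blast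
    have "m \<noteq> 0"
    proof
      assume "m = 0"
      then have "n < 2" using mr by (simp add: length_mu4 split: if_splits)
      then show False using False less.prems by simp
    qed
    then have m: "m \<ge> 1" "m < n" using pos_greater[of m] mr by auto
    define v where "v = stake 3 (sdrop m mu4_omega)"
    have hd: "hd v = mu4_omega !! m" by (simp add: v_def numeral_3_eq_3)
    have "v \<in> set factors3" using less.IH[OF m(2) m(1)] by (simp add: v_def)
    then have v: "3 \<le> length (drop r (mu4_word v))" "take 3 (drop r (mu4_word v)) \<in> set factors3"
      using factors3_closed mr(2) hd by auto
    have "sdrop n mu4_omega = sdrop r (sdrop (pos m) mu4_omega)"
      by (simp add: mr(1) sdrop_add)
    also have "\<dots> = drop r (mu4_word v) @- flat (smap mu4 (sdrop (m + 3) mu4_omega))"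
      unfolding sdrop_pos[of m 3] v_def[symmetric] using v(1) by (simp add: sdrop_shift)
    finally have "stake 3 (sdrop n mu4_omega) = take 3 (drop r (mu4_word v))"
      using v(1) by (simp add: stake_shift)
    then show ?thesis using v(2) by simp
  qed
qed

definition seqA :: "nat \<Rightarrow> nat" where
  "seqA m = pos m + 1 + rho4 (mu4_omega !! m)"

text \<open>The floor for \<open>phi\<^sup>2\<close> exceeds that for \<open>phi\<close> by
  \<open>m + 1\<close>, and 3 more are added. Differences thus start at 5, leaving 0 to 4 to the
  terminal positions.\<close>

definition seqB :: "nat \<Rightarrow> nat" where
  "seqB m = seqA m + m + 4"

text \<open>
  Natural subtraction does not truncate here: \<open>seqA\<close> is increasing from index 1 on, as is checked on
  the factors.
\<close>

definition gap :: "letter \<Rightarrow> letter \<Rightarrow> nat" where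
  "gap x y = length (mu4 x) + rho4 y - rho4 x"

text \<open>For the window at \<open>m\<close>, \<open>i\<close> is the offset of index
  \<open>seqA m\<close> in its image \<open>u\<close>, and \<open>d\<close> is the increment of
  \<open>seqA\<close> at \<open>m\<close>. The check says that the increment of \<open>seqA\<close>
  at \<open>seqA m\<close> is 2, and the following one is 1 if \<open>d = 2\<close>.\<close>

lemma factors3_gaps:
  "\<forall>v\<in>set factors3.
     let u = mu4_word v; i = 1 + rho4 (v ! 0); d = gap (v ! 0) (v ! 1)
     in rho4 (v ! 0) \<le> length (mu4 (v ! 0)) + rho4 (v ! 1) \<and> i + d < length u \<and>
        (d = 1 \<or> d = 2) \<and> gap (u ! i) (u ! (i + 1)) = 2 \<and>
        (d = 2 \<longrightarrow> gap (u ! (i + 1)) (u ! (i + 2)) = 1)"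
  by code_simp

context
  fixes m :: nat
  assumes m: "m \<ge> 1"
begin

private definition "v = stake 3 (sdrop m mu4_omega)"

private lemma v_nth: "v ! 0 = mu4_omega !! m" "v ! Suc 0 = mu4_omega !! Suc m"
  by (simp_all add: v_def numeral_3_eq_3)

private lemma factor:
  "rho4 (v ! 0) \<le> length (mu4 (v ! 0)) + rho4 (v ! 1)"
  "1 + rho4 (v ! 0) + gap (v ! 0) (v ! 1) < length (mu4_word v)"
  "gap (v ! 0) (v ! 1) = 1 \<or> gap (v ! 0) (v ! 1) = 2"
  "gap (mu4_word v ! (1 + rho4 (v ! 0))) (mu4_word v ! (1 + rho4 (v ! 0) + 1)) = 2"
  "gap (v ! 0) (v ! 1) = 2 \<longrightarrow>
    gap (mu4_word v ! (1 + rho4 (v ! 0) + 1)) (mu4_word v ! (1 + rho4 (v ! 0) + 2)) = 1"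
  using factors3_gaps window_in_factors3[OF m] unfolding v_def Let_def by blast+

private lemma word_at_seqA:
  "k \<le> gap (v ! 0) (v ! 1) \<Longrightarrow>
    mu4_omega !! (seqA m + k) = mu4_word v ! (1 + rho4 (v ! 0) + k)"
  using nth_pos_window[of "1 + rho4 (v ! 0) + k" 3 m] factor(2)
  by (simp add: seqA_def v_nth(1) v_def add.assoc)

lemma seqA_Suc: "seqA (Suc m) = seqA m + gap (mu4_omega !! m) (mu4_omega !! Suc m)"
  using factor(1) by (simp add: seqA_def pos_Suc gap_def v_nth del: snth.simps)

lemma gap_cases: "gap (mu4_omega !! m) (mu4_omega !! Suc m) \<in> {1, 2}"
  using factor(3) by (simp add: v_nth del: snth.simps)

lemma gap_at_seqA: "gap (mu4_omega !! seqA m) (mu4_omega !! Suc (seqA m)) = 2"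
  using factor(3,4) word_at_seqA[of 0] word_at_seqA[of 1] by (auto simp del: snth.simps)

lemma gap_after_seqA:
  assumes "gap (mu4_omega !! m) (mu4_omega !! Suc m) = 2"
  shows "gap (mu4_omega !! Suc (seqA m)) (mu4_omega !! Suc (Suc (seqA m))) = 1"
  using factor(5) word_at_seqA[of 1] word_at_seqA[of 2] assms by (simp add: v_nth del: snth.simps)

end

section \<open>Monotonicity and complementarity from index 1 on\<close>

lemma seqA_less:
  assumes "1 \<le> i" "i < j"
  shows "seqA i < seqA j"
proof -
  have "seqA m < seqA (Suc m)" if "m \<ge> 1" for m
    using seqA_Suc[OF that] gap_cases[OF that] by auto
  note step = this
  show ?thesis using assms(2)
  proof (induction j)
    case (Suc j)
    then show ?case
      using step[of j] assms(1) by (cases "i = j") (auto intro: less_trans)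
  qed simp
qed

lemma seqA_less_iff: "1 \<le> i \<Longrightarrow> 1 \<le> j \<Longrightarrow> seqA i < seqA j \<longleftrightarrow> i < j"
  using seqA_less[of i j] seqA_less[of j i] by (cases i j rule: linorder_cases) auto

lemma seqA_eq_iff: "1 \<le> i \<Longrightarrow> 1 \<le> j \<Longrightarrow> seqA i = seqA j \<longleftrightarrow> i = j"
  using seqA_less[of i j] seqA_less[of j i] by (cases i j rule: linorder_cases) auto

lemma seqA_1: "seqA 1 = 5"
  using mu4_omega_prefix(1,2) by (simp add: seqA_def pos_Suc)

lemma seqA_ge_5: "m \<ge> 1 \<Longrightarrow> seqA m \<ge> 5"
  using seqA_less[of 1 m] seqA_1 by (cases "m = 1") auto

lemma gap_below_5:
  assumes "1 \<le> j" "j < 5"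
  shows "gap (mu4_omega !! j) (mu4_omega !! Suc j) = 1"
proof -
  have "j = 1 \<or> j = 2 \<or> j = 3 \<or> j = 4" using assms by auto
  then show ?thesis
    using mu4_omega_prefix by (auto simp: gap_def eval_nat_numeral)
qed

lemma seqA_interval:
  assumes "n \<ge> 5"
  obtains m where "m \<ge> 1" "seqA m \<le> n" "n < seqA (Suc m)"
proof -
  have "\<exists>m\<ge>1. seqA m \<le> n \<and> n < seqA (Suc m)"
    using assms
  proof (induction n rule: dec_induct)
    case base
    then show ?case using seqA_1 seqA_less[of 1 2] by (intro exI[of _ 1]) (auto simp: numeral_2_eq_2)
  next
    case (step n)
    then obtain m where m: "m \<ge> 1" "seqA m \<le> n" "n < seqA (Suc m)" by blast
    show ?case
    proof (cases "Suc n < seqA (Suc m)")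
      case True
      then show ?thesis using m by (intro exI[of _ m]) auto
    next
      case False
      then have "Suc n = seqA (Suc m)" using m by simp
      then show ?thesis using m seqA_less[of "Suc m" "Suc (Suc m)"] by (intro exI[of _ "Suc m"]) auto
    qed
  qed
  then show thesis using that by blast
qed

text \<open>If \<open>seqA\<close> grows by \<open>d\<close> at \<open>m\<close>, the
  \<open>d\<close> gaps from index \<open>seqA m\<close> on are 2, or 2 and 1. They sum to
  \<open>d + 1\<close>, the growth of \<open>seqB\<close>.\<close>

lemma seqA_seqA: "m \<ge> 1 \<Longrightarrow> Suc (seqA (seqA m)) = seqB m"
proof (induction m rule: dec_induct)
  case base
  \<comment> \<open>The gaps at indices 1 to 4 are 1, so \<open>seqA 5 = 9\<close> and
    \<open>seqB 1 = 10\<close>.\<close>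
  have "seqA (1 + k) = 5 + k" if "k \<le> 4" for k
    using that
  proof (induction k)
    case (Suc k)
    then show ?case using seqA_Suc[of "1 + k"] gap_below_5[of "1 + k"] by simp
  qed (use seqA_1 in simp)
  from this[of 4] show ?case using seqA_1 by (simp add: seqB_def)
next
  case (step m)
  have ge: "seqA m \<ge> 1" using seqA_ge_5[OF step.hyps(1)] by simp
  have 1: "seqA (Suc (seqA m)) = seqA (seqA m) + 2"
    using seqA_Suc[OF ge] gap_at_seqA[OF step.hyps(1)] by simp
  have "gap (mu4_omega !! m) (mu4_omega !! Suc m) \<in> {1, 2}" by (rule gap_cases[OF step.hyps(1)])
  then have "seqA (seqA (Suc m)) = seqA (seqA m) + gap (mu4_omega !! m) (mu4_omega !! Suc m) + 1"
    using 1 seqA_Suc[OF step.hyps(1)] seqA_Suc[of "Suc (seqA m)"] gap_after_seqA[OF step.hyps(1)]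
    by auto
  then show ?case using step.IH seqA_Suc[OF step.hyps(1)] by (simp add: seqB_def)
qed

text \<open>An omitted \<open>n\<close> follows some \<open>seqA j\<close> inside a gap of 2. If
  \<open>j\<close> were itself omitted, it would directly follow a value of \<open>seqA\<close>,
  where the gap is only 1; so \<open>j = seqA m\<close>.\<close>

lemma seqA_or_seqB:
  assumes "n \<ge> 5"
  shows "\<exists>m\<ge>1. n = seqA m \<or> n = seqB m"
proof -
  obtain j where j: "j \<ge> 1" "seqA j \<le> n" "n < seqA (Suc j)" using seqA_interval[OF assms] .
  show ?thesis
  proof (cases "n = seqA j")
    case False
    then have n: "n = Suc (seqA j)" and gap2: "gap (mu4_omega !! j) (mu4_omega !! Suc j) = 2"
      using j seqA_Suc[OF j(1)] gap_cases[OF j(1)] by auto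
    then have "j \<ge> 5" using gap_below_5[of j] j(1) by (cases "j < 5") auto
    then obtain m where m: "m \<ge> 1" "seqA m \<le> j" "j < seqA (Suc m)" using seqA_interval by blast
    have "j = seqA m"
    proof (rule ccontr)
      assume "j \<noteq> seqA m"
      then have "j = Suc (seqA m)" "gap (mu4_omega !! m) (mu4_omega !! Suc m) = 2"
        using m seqA_Suc[OF m(1)] gap_cases[OF m(1)] by auto
      then show False using gap2 gap_after_seqA[OF m(1)] by simp
    qed
    then show ?thesis using n seqA_seqA[OF m(1)] m(1) by metis
  qed (use j in blast)
qed

text \<open>\<open>seqB m\<close> is the middle of the gap of 2 between the consecutive terms at
  \<open>seqA m\<close> and \<open>Suc (seqA m)\<close>.\<close>

lemma seqA_neq_seqB:
  assumes "i \<ge> 1" "m \<ge> 1"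
  shows "seqA i \<noteq> seqB m"
proof
  assume eq: "seqA i = seqB m"
  have ge: "seqA m \<ge> 1" using seqA_ge_5[OF assms(2)] by simp
  have "seqA (Suc (seqA m)) = seqB m + 1"
    using seqA_Suc[OF ge] gap_at_seqA[OF assms(2)] seqA_seqA[OF assms(2)] by simp
  then have "seqA (seqA m) < seqA i" "seqA i < seqA (Suc (seqA m))"
    using eq seqA_seqA[OF assms(2)] by simp_all
  then show False using seqA_less_iff[of _ i] seqA_less_iff[of i] assms(1) ge by simp
qed

lemma seqB_eq_iff: "1 \<le> i \<Longrightarrow> 1 \<le> j \<Longrightarrow> seqB i = seqB j \<longleftrightarrow> i = j"
  using seqA_less[of i j] seqA_less[of j i] by (cases i j rule: linorder_cases) (auto simp: seqB_def)


section \<open>The P-positions\<close>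

definition P4 :: "position set" where
  "P4 = {(x, y). x + y \<le> 4 \<or>
     (\<exists>m\<ge>1. x = seqA m \<and> y = seqB m \<or> x = seqB m \<and> y = seqA m)}"

lemma P4_swap: "(y, x) \<in> P4 \<longleftrightarrow> (x, y) \<in> P4"
  by (auto simp: P4_def)

lemma P4_pair: "m \<ge> 1 \<Longrightarrow> (seqA m, seqB m) \<in> P4"
  by (auto simp: P4_def)

text \<open>A shared coordinate fixes the pair by injectivity and disjointness of the sequences; a
  diagonal move keeps the difference \<open>m + 4\<close>, which fixes \<open>m\<close> and the
  order.\<close>

lemma P4_independent_aux:
  assumes "m \<ge> 1" and mv: "wythoff_move (seqA m, seqB m) (x, y)"
  shows "(x, y) \<notin> P4"
proof
  assume "(x, y) \<in> P4"
  have A5: "seqA k \<ge> 5" if "k \<ge> 1" for k using seqA_ge_5 that .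
  have mv': "x < seqA m \<and> y = seqB m \<or> x = seqA m \<and> y < seqB m \<or>
      x < seqA m \<and> y < seqB m \<and> seqA m + y = x + seqB m"
    using mv by (simp add: wythoff_move_iff)
  \<comment> \<open>A diagonal move keeps \<open>y - x = m + 4\<close>, at least 5 since
    \<open>m \<ge> 1\<close>; any other move keeps a coordinate that is at least 5.\<close>
  then have "x + y > 4" using A5[OF assms(1)] assms(1) by (auto simp: seqB_def)
  then obtain k where k: "k \<ge> 1" "x = seqA k \<and> y = seqB k \<or> x = seqB k \<and> y = seqA k"
    using \<open>(x, y) \<in> P4\<close> by (auto simp: P4_def)
  from k(2) show False
  proof
    assume "x = seqA k \<and> y = seqB k"
    then show False
      using mv' seqA_eq_iff[OF k(1) assms(1)] seqB_eq_iff[OF k(1) assms(1)]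
      by (auto simp: seqB_def)
  next
    assume "x = seqB k \<and> y = seqA k"
    then show False
      using mv' seqA_neq_seqB[OF k(1) assms(1)] seqA_neq_seqB[OF assms(1) k(1)]
      by (auto simp: seqB_def)
  qed
qed

text \<open>By complementarity a coordinate \<open>x \<ge> 5\<close> has a partner. If
  \<open>y\<close> is too small to be lowered to it, the difference \<open>y - x\<close> is below
  \<open>m + 4\<close> and a diagonal move reaches \<open>P4\<close>.\<close>

lemma P4_absorbing_aux:
  assumes "(x, y) \<notin> P4" "x \<le> y"
  shows "\<exists>x' y'. (x', y') \<in> P4 \<and> wythoff_move (x, y) (x', y')"
proof (cases "x \<le> 4")
  case True
  then have "y > 0" "(x, 0) \<in> P4" using assms by (auto simp: P4_def)
  then show ?thesis by (auto simp: wythoff_move_iff)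
next
  case False
  then obtain m where m: "m \<ge> 1" "x = seqA m \<or> x = seqB m" using seqA_or_seqB[of x] by auto
  from m(2) show ?thesis
  proof
    assume x: "x = seqB m"
    then have "seqA m < y" using assms(2) by (simp add: seqB_def)
    then show ?thesis
      using P4_pair[OF m(1)] P4_swap x by (auto simp: wythoff_move_iff)
  next
    assume x: "x = seqA m"
    then have "y \<noteq> seqB m" using assms(1) P4_pair[OF m(1)] by auto
    then consider "y > seqB m" | "y < seqB m" "y - x \<le> 4" | "y < seqB m" "y - x > 4"
      by linarith
    then show ?thesis
    proof cases
      case 1
      then show ?thesis using P4_pair[OF m(1)] x by (auto simp: wythoff_move_iff)
    next
      case 2
      then have "(0, y - x) \<in> P4" by (simp add: P4_def)
      moreover have "wythoff_move (x, y) (0, y - x)"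
        using False assms(2) by (auto simp: wythoff_move_iff)
      ultimately show ?thesis by blast
    next
      case 3
      \<comment> \<open>The index whose pair has difference \<open>y - x\<close>;
        \<open>k < m\<close> gives \<open>seqA k < x\<close>.\<close>
      define k where "k = y - x - 4"
      have k: "1 \<le> k" "k < m" "y = x + k + 4"
        using 3 x by (auto simp: k_def seqB_def)
      then have "wythoff_move (x, y) (seqA k, seqB k)"
        using seqA_less[OF k(1,2)] x by (auto simp: wythoff_move_iff seqB_def)
      then show ?thesis using P4_pair[OF k(1)] by blast
    qed
  qed
qed

interpretation P4: kernel 4 P4
proof
  show "p \<in> P4" if "terminal 4 p" for p
    using that by (cases p) (simp add: terminal_def P4_def)
  show "q \<notin> P4" if p: "p \<in> P4" "K_move 4 p q" for p q
  proof -
    obtain x y x' y' where xy: "p = (x, y)" "q = (x', y')" by (cases p, cases q)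
    have mv: "wythoff_move (x, y) (x', y')" "x + y > 4"
      using p(2) xy by (auto simp: K_move_def terminal_def)
    then obtain m where m: "m \<ge> 1" "x = seqA m \<and> y = seqB m \<or> x = seqB m \<and> y = seqA m"
      using p(1) xy by (auto simp: P4_def)
    from m(2) show ?thesis
      using P4_independent_aux[OF m(1), of x' y'] P4_independent_aux[OF m(1), of y' x'] mv(1) xy
        P4_swap[of x' y'] wythoff_move_swap[of y x y' x'] by auto
  qed
  show "\<exists>q\<in>P4. K_move 4 p q" if "p \<notin> P4" for p
  proof -
    obtain x y where p: "p = (x, y)" by (cases p)
    have "\<exists>x' y'. (x', y') \<in> P4 \<and> wythoff_move (x, y) (x', y')"
    proof (cases "x \<le> y")
      case True
      then show ?thesis using P4_absorbing_aux that p by blast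
    next
      case False
      then have "\<exists>y' x'. (y', x') \<in> P4 \<and> wythoff_move (y, x) (y', x')"
        using P4_absorbing_aux[of y x] that p P4_swap by auto
      then show ?thesis using P4_swap wythoff_move_swap by blast
    qed
    moreover have "\<not> terminal 4 p" using that p by (auto simp: terminal_def P4_def)
    ultimately show ?thesis unfolding p K_move_def by blast
  qed
qed

theorem theorem14:
  fixes a b :: nat
  assumes "a \<le> b"
  shows "P_position 4 (a, b) \<longleftrightarrow>
    a + b \<le> 4 \<or>
    (\<exists>n::nat. int a = \<lfloor>real (n + 2) * phi\<rfloor> + int (g4 (n + 1)) \<and>
              int b = \<lfloor>real (n + 2) * phi\<^sup>2\<rfloor> + int (g4 (n + 1)) + 3)"
proof -
  \<comment> \<open>Here \<open>m = Suc n\<close>, so the multiplier \<open>n + 2\<close> is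
    \<open>m + 1\<close>.\<close>
  have A: "\<lfloor>real (n + 2) * phi\<rfloor> + int (g4 (n + 1)) = int (seqA (Suc n))" for n
    using floor_phi_multiple[of "Suc n"] by (simp add: seqA_def g4_def)
  have B: "\<lfloor>real (n + 2) * phi\<^sup>2\<rfloor> + int (g4 (n + 1)) + 3 = int (seqB (Suc n))" for n
    using floor_phi_square_multiple[of "Suc n"] by (simp add: seqA_def seqB_def g4_def)
  \<comment> \<open>Since \<open>seqA m < seqB m\<close>, the assumption \<open>a \<le> b\<close>
    rules out the swapped pairs.\<close>
  have "P_position 4 (a, b) \<longleftrightarrow> a + b \<le> 4 \<or> (\<exists>m\<ge>1. a = seqA m \<and> b = seqB m)"
    unfolding P4.P_position_iff using assms by (auto simp: P4_def seqB_def)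
  also have "\<dots> \<longleftrightarrow> a + b \<le> 4 \<or> (\<exists>n. a = seqA (Suc n) \<and> b = seqB (Suc n))"
    by (metis Suc_le_D le_add1 One_nat_def plus_1_eq_Suc)
  finally show ?thesis unfolding A B by simp
qed

end
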